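(* For all $r\in\mathbb{N}$ and $n\in\mathbb{Z}$, $$\overline{c}_r(n)=\sum_{d\mid (n,r)} d\,\overline{\mu}_r(r/d).$$
   Context: $\mathbb{N}$ is the set of positive integers; $(n,r)$ is the greatest common divisor (so $(0,r)=r$), and sums over $d\mid m$ run over positive divisors. An integer $a$ is regular (mod $r$) if there is an integer $x$ with $a^2x\equiv a \pmod r$. Define $$\overline{c}_r(n)=\sum_{\substack{a \pmod r\\ a\text{ regular}\pmod r}}\exp(2\pi i a n/r),$$ the sum being over the regular elements $a$ of a complete residue system mod $r$ (e.g. $1\le a\le r$). A divisor $d$ of $m$ is a unitary divisor, written $d\,\|\,m$, if $(d,m/d)=1$. For fixed $r\in\mathbb{N}$ let $g_r:\mathbb{N}\to\mathbb{C}$ be $g_r(n)=1$ if $n\,\|\,r$ and $g_r(n)=0$ otherwise, and let $\overline{\mu}_r:\mathbb{N}\to\mathbb{C}$ be the unique function with $\sum_{d\mid n}\overline{\mu}_r(d)=g_r(n)$ for all $n\in\mathbb{N}$. *)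

theory Defs
  imports Complex_Main "HOL-Number_Theory.Cong"
begin

definition regular_mod :: "int \<Rightarrow> nat \<Rightarrow> bool" where
  "regular_mod a r \<longleftrightarrow> (\<exists>x::int. [a\<^sup>2 * x = a] (mod int r))"

definition cbar :: "nat \<Rightarrow> int \<Rightarrow> complex" where
  "cbar r n =
     (\<Sum>a\<in>{a\<in>{1..int r}. regular_mod a r}.
        exp (2 * of_real pi * \<i> * of_int a * of_int n / of_nat r))"

definition unitary_dvd :: "nat \<Rightarrow> nat \<Rightarrow> bool" where
  "unitary_dvd d m \<longleftrightarrow> d dvd m \<and> coprime d (m div d)"

definition unitary_ind :: "nat \<Rightarrow> nat \<Rightarrow> complex" where
  "unitary_ind r n = (if unitary_dvd n r then 1 else 0)"

text \<open>The domain of an arithmetic function is the set of positive integers; the clause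
  \<open>f 0 = 0\<close> only fixes the irrelevant value at \<open>0\<close>, so that the description is unique
  (see \<open>mubar_ex1\<close>).\<close>

definition mubar :: "nat \<Rightarrow> nat \<Rightarrow> complex" where
  "mubar r = (THE f. f 0 = 0 \<and> (\<forall>n>0. (\<Sum>d | d dvd n. f d) = unitary_ind r n))"

lemma sum_divisors_split:
  fixes f :: "nat \<Rightarrow> complex"
  assumes "n > 0"
  shows "(\<Sum>d | d dvd n. f d) = f n + (\<Sum>d | d dvd n \<and> d < n. f d)"
proof -
  have "{d. d dvd n} = insert n {d. d dvd n \<and> d < n}"
    using assms by (auto dest: dvd_imp_le)
  moreover have "finite {d. d dvd n \<and> d < n}"
    using assms by simp
  ultimately show ?thesis
    by simp
qed

lemma mubar_ex1:
  "\<exists>!f :: nat \<Rightarrow> complex. f 0 = 0 \<and> (\<forall>n>0. (\<Sum>d | d dvd n. f d) = unitary_ind r n)"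
proof (rule ex_ex1I)
  define F where "F = (\<lambda>(f :: nat \<Rightarrow> complex) n.
    if n = 0 then 0 else unitary_ind r n - (\<Sum>d | d dvd n \<and> d < n. f d))"
  define f where "f = wfrec less_than F"
  have "adm_wf less_than F"
    unfolding adm_wf_def F_def by (auto intro!: sum.cong)
  then have f: "f n = F f n" for n
    unfolding f_def by (rule wfrec_fixpoint[OF wf_less_than, THEN fun_cong])
  have "f 0 = 0"
    by (subst f) (simp add: F_def)
  moreover have "(\<Sum>d | d dvd n. f d) = unitary_ind r n" if "n > 0" for n
    using that by (simp add: sum_divisors_split f[of n] F_def)
  ultimately show
    "\<exists>f :: nat \<Rightarrow> complex. f 0 = 0 \<and> (\<forall>n>0. (\<Sum>d | d dvd n. f d) = unitary_ind r n)"
    by blast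
next
  fix f g :: "nat \<Rightarrow> complex"
  assume f: "f 0 = 0 \<and> (\<forall>n>0. (\<Sum>d | d dvd n. f d) = unitary_ind r n)"
    and g: "g 0 = 0 \<and> (\<forall>n>0. (\<Sum>d | d dvd n. g d) = unitary_ind r n)"
  have "f n = g n" for n
  proof (induction n rule: less_induct)
    case (less n)
    show ?case
    proof (cases "n = 0")
      case False
      then have n: "n > 0" by simp
      have "(\<Sum>d | d dvd n \<and> d < n. f d) = (\<Sum>d | d dvd n \<and> d < n. g d)"
        by (rule sum.cong) (use less in auto)
      moreover have "(\<Sum>d | d dvd n. f d) = (\<Sum>d | d dvd n. g d)"
        using f g n by metis
      ultimately show ?thesis
        using n by (simp add: sum_divisors_split)
    qed (use f g in simp)
  qed
  then show "f = g" by blast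
qed

lemma mubar_sum_divisors:
  assumes "n > 0"
  shows "(\<Sum>d | d dvd n. mubar r d) = unitary_ind r n"
  using theI'[OF mubar_ex1[of r]] assms unfolding mubar_def by blast

end

theory Submission
  imports Defs "HOL-Analysis.Complex_Transcendental"
begin

text \<open>An element \<open>a\<close> is regular mod \<open>r\<close> iff \<open>(a, r)\<close> is a unitary divisor of \<open>r\<close>, so the
  indicator of regularity is \<open>\<Sum>d | d dvd (a, r). mubar r d\<close>. Interchanging the sums leaves, for each
  \<open>d\<close> dividing \<open>r\<close>, the full exponential sum over the multiples of \<open>d\<close>, which is \<open>r/d\<close> or \<open>0\<close>
  according to whether \<open>r/d\<close> divides \<open>n\<close>; finally \<open>d\<close> is replaced by \<open>r/d\<close>.\<close>

text \<open>With \<open>g = gcd a r\<close>, write \<open>a = g * b\<close> and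
  \<open>r = g * m\<close>, where \<open>b\<close> and \<open>m\<close> are coprime. The congruence
  defining regularity then reduces to \<open>a * x = 1\<close> modulo \<open>m\<close>. This is
  solvable iff \<open>a\<close> is coprime to \<open>m\<close>, and since \<open>b\<close> already
  is, iff \<open>g\<close> is coprime to \<open>m\<close>, the cofactor of \<open>g\<close> in
  \<open>r\<close>.\<close>

lemma regular_mod_iff_unitary_gcd:
  fixes a :: int
  assumes "r > 0"
  shows "regular_mod a r \<longleftrightarrow> unitary_dvd (nat (gcd a (int r))) r"
proof -
  define g where "g = gcd a (int r)"
  have "g > 0" using assms by (simp add: g_def)
  obtain b m where a: "a = g * b" and r: "int r = g * m"
    using dvdE gcd_dvd1 gcd_dvd2 unfolding g_def by metis
  have "coprime b m"
    using \<open>g > 0\<close> g_def unfolding a r by (simp add: gcd_mult_left coprime_iff_gcd_eq_1)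
  have m: "m = int (r div nat g)"
    using \<open>g > 0\<close> r by (simp add: zdiv_int)
  have "nat g dvd r"
    using \<open>g > 0\<close> by (simp add: g_def nat_dvd_iff)
  then have "unitary_dvd (nat g) r \<longleftrightarrow> coprime (int (nat g)) m"
    unfolding unitary_dvd_def m coprime_int_iff by simp
  also have "\<dots> \<longleftrightarrow> coprime a m"
    using \<open>g > 0\<close> \<open>coprime b m\<close> by (simp add: a coprime_mult_left_iff)
  also have "\<dots> \<longleftrightarrow> (\<exists>x. [a * x = 1] (mod m))"
    by (metis coprime_iff_invertible_int)
  also have "\<dots> \<longleftrightarrow> regular_mod a r"
  proof -
    have "[a\<^sup>2 * x = a] (mod int r) \<longleftrightarrow> [a * x = 1] (mod m)" for x
    proof -
      have "a\<^sup>2 * x - a = g * (b * (a * x - 1))"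
        by (simp add: a power2_eq_square algebra_simps)
      then have "[a\<^sup>2 * x = a] (mod int r) \<longleftrightarrow> m dvd b * (a * x - 1)"
        using \<open>g > 0\<close> by (simp add: cong_iff_dvd_diff r)
      then show ?thesis
        using \<open>coprime b m\<close>
        by (simp add: cong_iff_dvd_diff coprime_dvd_mult_right_iff coprime_commute)
    qed
    then show ?thesis by (simp add: regular_mod_def)
  qed
  finally show ?thesis by (simp add: g_def)
qed

text \<open>The terms are the powers of \<open>w = exp (2 pi i n / m)\<close>, an
  \<open>m\<close>-th root of unity, so the geometric sum vanishes unless
  \<open>w = 1\<close>.\<close>

lemma sum_exp_complete_residue_system:
  fixes n :: int
  assumes "m > 0"
  shows "(\<Sum>b\<in>{1..m}. exp (2 * of_real pi * \<i> * of_nat b * of_int n / of_nat m)) =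
    (if int m dvd n then of_nat m else (0::complex))"
proof -
  define w where "w = exp (2 * of_real pi * \<i> * (of_int n / of_nat m))"
  have w: "exp (2 * of_real pi * \<i> * of_nat b * of_int n / of_nat m) = w ^ b" for b
    unfolding w_def exp_of_nat_mult[symmetric] by (simp add: algebra_simps)
  have "w ^ m = exp (2 * of_int n * of_real pi * \<i>)"
    unfolding w_def exp_of_nat_mult[symmetric] using assms by (simp add: algebra_simps)
  then have "w ^ m = 1"
    using exp_integer_2pi[of "of_int n"] by simp
  have "w = 1 \<longleftrightarrow> (\<exists>k::int. real_of_int n / real m = of_int k)"
  proof -
    \<comment> \<open>For \<open>\<i>\<close> times a real number, the criterion for
      \<open>exp z = 1\<close> constrains only the imaginary part, which must be an even multiple
      \<open>2 * k\<close> of \<open>pi\<close>.\<close>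
    have "w = exp (\<i> * of_real ((2 * pi) * (of_int n / of_nat m)))"
      by (simp add: w_def algebra_simps)
    moreover have "2 * pi * (of_int n / of_nat m) = of_int (2 * k) * pi \<longleftrightarrow>
        real_of_int n / real m = of_int k" for k
    proof -
      have "of_int (2 * k) * pi = 2 * pi * of_int k" by simp
      then show ?thesis
        by (metis mult_cancel_left mult_eq_0_iff pi_neq_zero zero_neq_numeral)
    qed
    ultimately show ?thesis
      by (simp only: exp_eq_1 Re_i_times Im_i_times Re_complex_of_real Im_complex_of_real) simp
  qed
  also have "\<dots> \<longleftrightarrow> (\<exists>k::int. n = int m * k)"
  proof -
    have "real_of_int n / real m = of_int k \<longleftrightarrow> n = int m * k" for k
    proof -
      have "real_of_int n / real m = of_int k \<longleftrightarrow> real_of_int n = real_of_int (int m * k)"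
        using assms by (simp add: divide_eq_eq mult.commute)
      then show ?thesis by (simp only: of_int_eq_iff)
    qed
    then show ?thesis by simp
  qed
  finally have "w = 1 \<longleftrightarrow> int m dvd n"
    by (auto simp: dvd_def)
  \<comment> \<open>The index starts at 1, so for \<open>w \<noteq> 1\<close> the sum is
    \<open>(w - w ^ (m + 1)) / (1 - w)\<close>, whose numerator is 0 by
    \<open>w ^ m = 1\<close>.\<close>
  then show ?thesis
    using assms \<open>w ^ m = 1\<close> unfolding w by (auto simp: sum_gp)
qed

text \<open>The multiples of \<open>d\<close> in the range are \<open>d * b\<close> with
  \<open>b\<close> from 1 to \<open>r div d\<close>, and \<open>d\<close> cancels in
  \<open>a / r\<close>. What remains is a complete exponential sum modulo
  \<open>r div d\<close>.\<close>

lemma sum_exp_multiples: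
  fixes n :: int
  assumes "r > 0" "d dvd r"
  shows "(\<Sum>a | a \<in> {1..int r} \<and> int d dvd a.
      exp (2 * of_real pi * \<i> * of_int a * of_int n / of_nat r)) =
    (if int (r div d) dvd n then of_nat (r div d) else (0::complex))"
proof -
  let ?e = "\<lambda>a::int. exp (2 * of_real pi * \<i> * of_int a * of_int n / of_nat r) :: complex"
  obtain m where r: "r = d * m" using assms by blast
  then have "d > 0" "m > 0" using assms by auto
  have "bij_betw (\<lambda>b. int (d * b)) {1..m} {a. a \<in> {1..int r} \<and> int d dvd a}"
  proof (rule bij_betwI[where g = "\<lambda>a. nat a div d"])
    show "(\<lambda>b. int (d * b)) \<in> {1..m} \<rightarrow> {a. a \<in> {1..int r} \<and> int d dvd a}"
    proof (intro funcsetI CollectI conjI)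
      fix b assume "b \<in> {1..m}"
      then have "1 \<le> d * b" "d * b \<le> r" using \<open>d > 0\<close> by (auto simp: r)
      then show "int (d * b) \<in> {1..int r}" unfolding atLeastAtMost_iff by linarith
    qed simp
    show "(\<lambda>a. nat a div d) \<in> {a. a \<in> {1..int r} \<and> int d dvd a} \<rightarrow> {1..m}"
      using \<open>d > 0\<close> \<open>m > 0\<close>
      by (auto simp: r dvd_def nat_mult_distrib zero_less_mult_iff int_one_le_iff_zero_less Suc_le_eq nat_le_iff)
    show "int (d * (nat a div d)) = a" if "a \<in> {a. a \<in> {1..int r} \<and> int d dvd a}" for a
    proof -
      have "d dvd nat a" "0 \<le> a" using that by (auto simp flip: int_dvd_int_iff)
      then show ?thesis by (simp only: dvd_mult_div_cancel int_nat_eq if_True)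
    qed
  qed (use \<open>d > 0\<close> in \<open>simp only: nat_int nonzero_mult_div_cancel_left\<close>)
  then have "(\<Sum>a | a \<in> {1..int r} \<and> int d dvd a. ?e a) = (\<Sum>b\<in>{1..m}. ?e (int (d * b)))"
    by (rule sum.reindex_bij_betw[symmetric])
  also have "\<dots> = (\<Sum>b\<in>{1..m}. exp (2 * of_real pi * \<i> * of_nat b * of_int n / of_nat m))"
    using \<open>d > 0\<close> by (intro sum.cong arg_cong[where f = exp]) (simp_all add: r)
  also have "\<dots> = (if int m dvd n then of_nat m else 0)"
    by (rule sum_exp_complete_residue_system[OF \<open>m > 0\<close>])
  finally show ?thesis
    using \<open>d > 0\<close> by (simp add: r)
qed

theorem theorem2p1:
  fixes r :: nat and n :: int
  assumes "r \<ge> 1"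
  shows "cbar r n = (\<Sum>d | d dvd nat (gcd n (int r)). of_nat d * mubar r (r div d))"
proof -
  have "r > 0" using assms by simp
  let ?e = "\<lambda>a::int. exp (2 * of_real pi * \<i> * of_int a * of_int n / of_nat r) :: complex"
  have ind: "(if regular_mod a r then 1 else 0) = (\<Sum>d | d dvd r \<and> int d dvd a. mubar r d)" for a
  proof -
    \<comment> \<open>The divisor sums of \<open>mubar r\<close> are prescribed only at positive
      arguments; the gcd is positive even for \<open>a = 0\<close>.\<close>
    have "nat (gcd a (int r)) > 0" using \<open>r > 0\<close> by simp
    moreover have "{d. d dvd nat (gcd a (int r))} = {d. d dvd r \<and> int d dvd a}"
      by (auto simp: nat_dvd_iff simp flip: int_dvd_int_iff)
    ultimately show ?thesis
      using mubar_sum_divisors[of "nat (gcd a (int r))" r]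
      by (simp add: regular_mod_iff_unitary_gcd[OF \<open>r > 0\<close>] unitary_ind_def)
  qed
  have "cbar r n = (\<Sum>a\<in>{1..int r}. (if regular_mod a r then 1 else 0) * ?e a)"
    unfolding cbar_def by (intro sum.mono_neutral_cong_left) auto
  also have "\<dots> = (\<Sum>a\<in>{1..int r}. \<Sum>d | d dvd r \<and> int d dvd a. mubar r d * ?e a)"
    by (simp only: ind sum_distrib_right)
  also have "\<dots> = (\<Sum>d | d dvd r. \<Sum>a | a \<in> {1..int r} \<and> int d dvd a. mubar r d * ?e a)"
    using sum.swap_restrict[of "{1..int r}" "{d. d dvd r}" "\<lambda>a d. mubar r d * ?e a" "\<lambda>a d. int d dvd a"]
      \<open>r > 0\<close> by simp
  also have "\<dots> = (\<Sum>d | d dvd r. mubar r d * (if int (r div d) dvd n then of_nat (r div d) else 0))"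
    using sum_exp_multiples[OF \<open>r > 0\<close>, of _ n] by (simp flip: sum_distrib_left)
  \<comment> \<open>Passing to the complementary divisor is an involution on the divisors of
    \<open>r\<close>, so the same map witnesses both directions.\<close>
  also have "\<dots> = (\<Sum>d | d dvd r. mubar r (r div d) * (if int d dvd n then of_nat d else 0))"
    by (rule sum.reindex_bij_witness[of _ "\<lambda>d. r div d" "\<lambda>d. r div d"])
      (use \<open>r > 0\<close> in \<open>auto simp: div_dvd_iff_mult\<close>)
  also have "\<dots> = (\<Sum>d | d dvd r \<and> int d dvd n. of_nat d * mubar r (r div d))"
    using \<open>r > 0\<close> by (intro sum.mono_neutral_cong_right) auto
  also have "{d. d dvd r \<and> int d dvd n} = {d. d dvd nat (gcd n (int r))}"
    by (auto simp: nat_dvd_iff simp flip: int_dvd_int_iff)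
  finally show ?thesis .
qed

end
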